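(* Under unilateral link formation with the smart adversary, for all integers $n\ge 3$, all $\alpha>0$, and every Nash equilibrium $S$ for $n$ players and link cost $\alpha$, $$\frac{C(S)}{\mathrm{OPT}(n,\alpha)}\;\le\;8+\frac{8}{n-1}\;=\;8+o(1)\quad(n\to\infty),$$ i.e. the price of anarchy is at most $8+\frac{8}{n-1}$.
   Context: Players are $V=\{1,\dots,n\}$ ($n\ge 3$), link cost is $\alpha>0$. A strategy profile is a matrix $S\in\{0,1\}^{n\times n}$ with $S_{vv}=0$; for $v\ne w$, $S_{vw}=1$ means that player $v$ requests the edge $\{v,w\}$. Unilateral link formation: the final graph is the simple undirected graph $G(S)=(V,E(S))$ with $E(S)=\{\{v,w\}: S_{vw}=1 \text{ or } S_{wv}=1\}$. Only essential profiles are considered ($S_{vw}=1\Rightarrow S_{wv}=0$). For a connected graph $G=(V,E)$, $e\in E$, $v\in V$, the relevance $\mathrm{rel}_G(e,v)$ is the number of vertices that, starting at $v$, can only be reached via $e$ (so it is $0$ iff $e$ is not a bridge). The separation $\mathrm{sep}(e)=\sum_{v\in V}\mathrm{rel}_G(e,v)$ is the number of ordered vertex pairs separated by removing $e$. Let $\mathrm{sep}_{\max}=\max_{e\in E}\mathrm{sep}(e)$ and $E_{\max}=\{e\in E:\mathrm{sep}(e)=\mathrm{sep}_{\max}\}$. The smart adversary removes one edge chosen uniformly at random from $E_{\max}$; so the disconnection cost of $v$ is $I_v(G)=\frac{1}{|E_{\max}|}\sum_{e\in E_{\max}}\mathrm{rel}_G(e,v)$ if $G$ is connected and $I_v(G)=\infty$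 otherwise. Individual cost: $C_v(S)=\alpha\sum_{w}S_{vw}+I_v(G(S))$. Social cost: $C(S)=\sum_{v\in V}C_v(S)$. $\mathrm{OPT}(n,\alpha)$ is the minimum of $C(S)$ over all strategy profiles. $S$ is a Nash equilibrium if no player $v$ can strictly decrease $C_v$ by changing her own row $S_v$ (arbitrarily) while the other rows stay fixed. The price of anarchy is the maximum of $C(S)/\mathrm{OPT}(n,\alpha)$ over Nash equilibria $S$. *)

theory Defs
  imports "HOL-Library.Extended_Real" "HOL-Library.Landau_Symbols"
begin

section \<open>Profiles and final graphs\<close>

definition players :: "nat \<Rightarrow> nat set" where
  "players n = {1..n}"

text \<open>\<open>S v w\<close> is the matrix entry \<open>S\<^sub>v\<^sub>w\<close>. Entries outside \<open>players n \<times> players n\<close> are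
  required to be \<open>False\<close>, so that distinct functions are distinct matrices.\<close>

type_synonym profile = "nat \<Rightarrow> nat \<Rightarrow> bool"

definition profiles :: "nat \<Rightarrow> profile set" where
  "profiles n = {S. \<forall>v w. S v w \<longrightarrow> v \<in> players n \<and> w \<in> players n \<and> v \<noteq> w}"

definition essential_profiles :: "nat \<Rightarrow> profile set" where
  "essential_profiles n = {S \<in> profiles n. \<forall>v w. S v w \<longrightarrow> \<not> S w v}"

definition edges :: "nat \<Rightarrow> profile \<Rightarrow> nat set set" where
  "edges n S = {{v, w} | v w. v \<in> players n \<and> w \<in> players n \<and> v \<noteq> w \<and> (S v w \<or> S w v)}"

section \<open>Relevance, separation and the smart adversary\<close>

text \<open>Graphs are given by their vertex set \<open>V\<close> and their set \<open>E\<close> of two-element edges.\<close>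

definition reachable :: "'a set set \<Rightarrow> 'a \<Rightarrow> 'a \<Rightarrow> bool" where
  "reachable E u w \<longleftrightarrow> (u, w) \<in> {(x, y). {x, y} \<in> E}\<^sup>*"

definition graph_connected :: "'a set \<Rightarrow> 'a set set \<Rightarrow> bool" where
  "graph_connected V E \<longleftrightarrow> (\<forall>u\<in>V. \<forall>w\<in>V. reachable E u w)"

definition relevance :: "'a set \<Rightarrow> 'a set set \<Rightarrow> 'a set \<Rightarrow> 'a \<Rightarrow> nat" where
  "relevance V E e v = card {w \<in> V. reachable E v w \<and> \<not> reachable (E - {e}) v w}"

definition separation :: "'a set \<Rightarrow> 'a set set \<Rightarrow> 'a set \<Rightarrow> nat" where
  "separation V E e = (\<Sum>v\<in>V. relevance V E e v)"

definition sep_max :: "'a set \<Rightarrow> 'a set set \<Rightarrow> nat" where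
  "sep_max V E = Max (separation V E ` E)"

definition max_sep_edges :: "'a set \<Rightarrow> 'a set set \<Rightarrow> 'a set set" where
  "max_sep_edges V E = {e \<in> E. separation V E e = sep_max V E}"

definition disconnection_cost :: "'a set \<Rightarrow> 'a set set \<Rightarrow> 'a \<Rightarrow> ereal" where
  "disconnection_cost V E v =
     (if graph_connected V E
      then ereal (1 / real (card (max_sep_edges V E)) *
                    (\<Sum>e\<in>max_sep_edges V E. real (relevance V E e v)))
      else \<infinity>)"

section \<open>Costs, equilibria and the price of anarchy\<close>

definition individual_cost :: "nat \<Rightarrow> real \<Rightarrow> profile \<Rightarrow> nat \<Rightarrow> ereal" where
  "individual_cost n \<alpha> S v =
     ereal (\<alpha> * (\<Sum>w\<in>players n. of_bool (S v w))) +
     disconnection_cost (players n) (edges n S) v"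

definition social_cost :: "nat \<Rightarrow> real \<Rightarrow> profile \<Rightarrow> ereal" where
  "social_cost n \<alpha> S = (\<Sum>v\<in>players n. individual_cost n \<alpha> S v)"

lemma finite_profiles: "finite (profiles n)"
proof (rule finite_subset)
  show "profiles n \<subseteq> (\<lambda>R v w. (v, w) \<in> R) ` Pow (players n \<times> players n)"
  proof
    fix S assume "S \<in> profiles n"
    then have "{(v, w). S v w} \<in> Pow (players n \<times> players n)"
      by (auto simp: profiles_def)
    moreover have "S = (\<lambda>v w. (v, w) \<in> {(v, w). S v w})"
      by simp
    ultimately show "S \<in> (\<lambda>R v w. (v, w) \<in> R) ` Pow (players n \<times> players n)"
      by blast
  qed
qed (simp add: players_def)

lemma profiles_nonempty: "profiles n \<noteq> {}"
  by (auto simp: profiles_def intro!: exI[of _ "\<lambda>_ _. False"])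

text \<open>The minimum ranges over all profiles, essential or not; it is attained at an essential one,
  since dropping a doubled request keeps the graph and saves \<open>\<alpha> > 0\<close>.\<close>

definition OPT :: "nat \<Rightarrow> real \<Rightarrow> ereal" where
  "OPT n \<alpha> = Min (social_cost n \<alpha> ` profiles n)"

text \<open>An equilibrium is an essential profile, but a deviation may be an arbitrary row,
  i.e. it may lead to a profile that is not essential.\<close>

definition nash_equilibrium :: "nat \<Rightarrow> real \<Rightarrow> profile \<Rightarrow> bool" where
  "nash_equilibrium n \<alpha> S \<longleftrightarrow>
     S \<in> essential_profiles n \<and>
     \<not> (\<exists>v\<in>players n. \<exists>s. S(v := s) \<in> profiles n \<and>
           individual_cost n \<alpha> (S(v := s)) v < individual_cost n \<alpha> S v)"

text \<open>A supremum over a finite set, hence a maximum whenever an equilibrium exists;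
  unlike \<open>Max\<close> it is also specified (as \<open>-\<infinity>\<close>) when there is none.\<close>

definition price_of_anarchy :: "nat \<Rightarrow> real \<Rightarrow> ereal" where
  "price_of_anarchy n \<alpha> = (SUP S \<in> {S. nash_equilibrium n \<alpha> S}. social_cost n \<alpha> S / OPT n \<alpha>)"

end

theory Submission
  imports Defs
begin

text \<open>The social cost of a connected profile is \<open>\<alpha> m + sep_max\<close>, where \<open>m\<close> is the number of
  requests. In an equilibrium \<open>m \<le> 2 (n - 1)\<close>: an edge outside two successive edge-disjoint
  spanning forests can be dropped without changing the bridges. Let \<open>sep_max = 2 s t\<close> with
  \<open>s + t = n\<close>, \<open>s \<le> t\<close>. A new edge across a worst bridge bounds the risk (expected
  disconnection cost) of its buyer by \<open>s\<close>, and, if its ends are chosen in all cuts heavier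
  than half of their side, by \<open>t / 2\<close>. The risk is never below \<open>s\<close>, and some player has risk at least the average \<open>2 s t / n\<close>. Hence \<open>\<alpha> \<ge> s - t / 2\<close> and
  \<open>\<alpha> \<ge> 2 s t / n - s\<close>; using the former for \<open>5 s \<ge> 2 n\<close> and the latter otherwise,
  \<open>sep_max \<le> 6 \<alpha> n\<close>. The optimum is at least \<open>min (\<alpha> n) ((\<alpha> + 2) (n - 1))\<close>, since a connected
  graph with fewer than \<open>n\<close> edges is a tree.\<close>

section \<open>Reachability\<close>

lemma reachable_refl [simp]: "reachable E u u"
  by (simp add: reachable_def)

lemma reachable_trans: "reachable E u v \<Longrightarrow> reachable E v w \<Longrightarrow> reachable E u w"
  unfolding reachable_def by (rule rtrancl_trans)

lemma reachable_edge: "{u, w} \<in> E \<Longrightarrow> reachable E u w"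
  unfolding reachable_def by (rule r_into_rtrancl) simp

lemma reachable_sym: "reachable E u w \<Longrightarrow> reachable E w u"
proof -
  have "sym {(x, y). {x, y} \<in> E}"
    by (auto simp: sym_def insert_commute)
  then show "reachable E u w \<Longrightarrow> reachable E w u"
    unfolding reachable_def by (meson sym_rtrancl symD)
qed

lemma reachable_eq: "reachable E u v \<Longrightarrow> reachable E u w \<longleftrightarrow> reachable E v w"
  by (meson reachable_sym reachable_trans)

lemma reachable_eq': "reachable E v w \<Longrightarrow> reachable E u v \<longleftrightarrow> reachable E u w"
  by (meson reachable_sym reachable_trans)

lemma reachable_mono: "reachable E u w \<Longrightarrow> E \<subseteq> E' \<Longrightarrow> reachable E' u w"
  unfolding reachable_def by (erule rtrancl_mono[THEN subsetD, rotated]) auto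

lemma reachable_induct [consumes 1, case_names refl step]:
  assumes "reachable E u w" and "P u"
    and "\<And>v v'. reachable E u v \<Longrightarrow> {v, v'} \<in> E \<Longrightarrow> P v \<Longrightarrow> P v'"
  shows "P w"
  using assms(1) unfolding reachable_def
  by (induction rule: rtrancl_induct) (use assms in \<open>auto simp: reachable_def\<close>)

text \<open>Each edge of the walk is replaced by a walk in \<open>E'\<close>; later this is how an
  edge with a bypass is eliminated.\<close>

lemma reachable_lift:
  assumes "reachable E u w" and "\<And>p q. {p, q} \<in> E \<Longrightarrow> reachable E' p q"
  shows "reachable E' u w"
  using assms(1) by (induction rule: reachable_induct) (simp, meson assms(2) reachable_trans)

text \<open>After its last use of the edge, a walk from \<open>p\<close> continues from
  \<open>p\<close> or from \<open>q\<close>. So deleting an edge splits a component into at most two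
  pieces, those of its ends.\<close>

lemma reachable_remove_edge:
  assumes "reachable E p u"
  shows "reachable (E - {{p, q}}) p u \<or> reachable (E - {{p, q}}) q u"
  using assms
proof (induction rule: reachable_induct)
  case (step v v')
  show ?case
  proof (cases "{v, v'} = {p, q}")
    case True
    then have "v' = p \<or> v' = q" by (auto simp: doubleton_eq_iff)
    then show ?thesis by auto
  next
    case False
    with step have "reachable (E - {{p, q}}) v v'"
      by (intro reachable_edge) auto
    with step.IH show ?thesis by (meson reachable_trans)
  qed
qed simp

text \<open>The walk meets no end of \<open>f\<close>, so it never uses \<open>f\<close> and
  survives when \<open>f\<close> is deleted in place of \<open>e\<close>.\<close>

lemma reachable_avoid:
  assumes "reachable (E - {e}) u w" and "\<And>z. z \<in> f \<Longrightarrow> \<not> reachable (E - {e}) u z"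
  shows "reachable (E - {f}) u w"
  using assms(1)
proof (induction rule: reachable_induct)
  case (step v v')
  then have "{v, v'} \<noteq> f" using assms(2) by auto
  with step show ?case
    by (intro reachable_trans[OF step.IH] reachable_edge) auto
qed simp

section \<open>Spanning forests\<close>

locale finite_graph =
  fixes V :: "'a set" and E :: "'a set set"
  assumes finite_V: "finite V"
    and edge_ends: "e \<in> E \<Longrightarrow> \<exists>u\<in>V. \<exists>w\<in>V. u \<noteq> w \<and> e = {u, w}"
begin

lemma finite_E: "finite E"
proof (rule finite_subset)
  show "E \<subseteq> Pow V" by (auto dest: edge_ends)
qed (simp add: finite_V)

lemma ends_in_V: "{p, q} \<in> E \<Longrightarrow> p \<in> V \<and> q \<in> V"
  using edge_ends[of "{p, q}"] by (auto simp: doubleton_eq_iff)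

end

definition components :: "'a set \<Rightarrow> 'a set set \<Rightarrow> 'a set set" where
  "components V F = (\<lambda>v. {w \<in> V. reachable F v w}) ` V"

text \<open>Sending an old component to the union of the new components of its members is a map onto
  the new components. It is not injective, since the components of \<open>a\<close> and
  \<open>b\<close> are merged.\<close>

lemma card_components_insert:
  assumes "finite V" "a \<in> V" "b \<in> V" "\<not> reachable F a b"
  shows "card (components V (insert {a, b} F)) < card (components V F)"
proof -
  define F' where "F' = insert {a, b} F"
  define c where "c = (\<lambda>v. {w \<in> V. reachable F v w})"
  define c' where "c' = (\<lambda>v. {w \<in> V. reachable F' v w})"
  have ab: "reachable F' a b"
    unfolding F'_def by (intro reachable_edge) simp
  have up: "c' v = (\<Union>w \<in> c v. c' w)" if "v \<in> V" for v
  proof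
    show "c' v \<subseteq> (\<Union>w \<in> c v. c' w)"
      using that by (force simp: c_def c'_def)
    have "reachable F' v w" if "reachable F v w" for w
      using that by (rule reachable_mono) (auto simp: F'_def)
    then show "(\<Union>w \<in> c v. c' w) \<subseteq> c' v"
      unfolding c_def c'_def by (blast intro: reachable_trans)
  qed
  define \<Phi> where "\<Phi> = (\<lambda>X. \<Union>w \<in> X. c' w)"
  have img: "\<Phi> ` (c ` V) = c' ` V"
    unfolding image_image by (rule image_cong) (use up in \<open>auto simp: \<Phi>_def\<close>)
  have "c' a = c' b"
    unfolding c'_def using ab by (intro Collect_cong) (meson reachable_sym reachable_trans)
  then have eq: "\<Phi> (c a) = \<Phi> (c b)"
    using up assms by (simp add: \<Phi>_def)
  have "b \<in> c b" "b \<notin> c a" using assms by (auto simp: c_def)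
  then have "c a \<noteq> c b" by blast
  then have "\<not> inj_on \<Phi> (c ` V)"
    using eq assms by (meson imageI inj_onD)
  then have "card (\<Phi> ` (c ` V)) < card (c ` V)"
    using assms(1) by (meson card_image_le eq_card_imp_inj_on finite_imageI le_neq_implies_less)
  then show ?thesis
    unfolding img by (simp add: components_def c_def c'_def F'_def)
qed

lemma (in finite_graph) spanning_forest:
  assumes "V \<noteq> {}"
  shows "\<exists>F\<subseteq>E. card F \<le> card V - 1 \<and> (\<forall>a b. {a, b} \<in> E \<longrightarrow> reachable F a b)"
proof -
  \<comment> \<open>Greedy choice: an edge enters \<open>F\<close> only if it joins two components,
    which costs at least one component. As at least one is left at the end, the invariant bounds
    \<open>card F\<close> by \<open>card V - 1\<close>.\<close>
  have "\<exists>F\<subseteq>E'. card F + card (components V F) \<le> card V \<and>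
          (\<forall>a b. {a, b} \<in> E' \<longrightarrow> reachable F a b)" if "finite E'" "E' \<subseteq> E" for E'
    using that
  proof (induction E' rule: finite_induct)
    case empty
    show ?case by (auto simp: components_def finite_V card_image_le)
  next
    case (insert e E')
    then obtain F where F: "F \<subseteq> E'" "card F + card (components V F) \<le> card V"
      "\<And>a b. {a, b} \<in> E' \<Longrightarrow> reachable F a b" by auto
    obtain a b where ab: "a \<in> V" "b \<in> V" "e = {a, b}"
      using edge_ends[of e] insert by auto
    show ?case
    proof (cases "reachable F a b")
      case True
      then have "reachable F p q" if "{p, q} \<in> insert e E'" for p q
        using that F(3)[of p q] reachable_sym[OF True] ab(3) by (auto simp: doubleton_eq_iff)
      with F(1,2) show ?thesis by (intro exI[of _ F]) blast
    next
      case False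
      have "finite F" using finite_subset[OF F(1) insert(1)] .
      moreover have "e \<notin> F" using F insert by blast
      ultimately have "card (insert e F) + card (components V (insert e F)) \<le> card V"
        using card_components_insert[OF finite_V ab(1,2) False] F(2) ab(3) by simp
      moreover have "reachable (insert e F) p q" if "{p, q} \<in> insert e E'" for p q
        using that F(3)[of p q] reachable_edge[of p q "insert e F"] reachable_mono[of F p q "insert e F"]
        by blast
      ultimately show ?thesis
        using F(1) by (intro exI[of _ "insert e F"]) blast
    qed
  qed
  from this[OF finite_E subset_refl] obtain F where F: "F \<subseteq> E"
    "card F + card (components V F) \<le> card V" "\<And>a b. {a, b} \<in> E \<Longrightarrow> reachable F a b"
    by auto
  have "card (components V F) > 0"
    using assms finite_V by (auto simp: components_def card_gt_0_iff)
  with F show ?thesis by (intro exI[of _ F]) auto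
qed

text \<open>An edge outside a spanning forest \<open>F1\<close> and a spanning forest \<open>F2\<close> of the remaining
  edges is bypassed by two edge-disjoint paths, of which any \<open>f\<close> hits at most one.\<close>

lemma (in finite_graph) redundant_edge:
  assumes "V \<noteq> {}" "2 * (card V - 1) < card E"
  shows "\<exists>a b. {a, b} \<in> E \<and> (\<forall>f. reachable (E - {{a, b}} - {f}) a b)"
proof -
  obtain F1 where F1: "F1 \<subseteq> E" "card F1 \<le> card V - 1" "\<And>a b. {a, b} \<in> E \<Longrightarrow> reachable F1 a b"
    using spanning_forest assms by blast
  interpret G2: finite_graph V "E - F1"
    by unfold_locales (use finite_V edge_ends in auto)
  obtain F2 where F2: "F2 \<subseteq> E - F1" "card F2 \<le> card V - 1"
    "\<And>a b. {a, b} \<in> E - F1 \<Longrightarrow> reachable F2 a b"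
    using G2.spanning_forest assms by blast
  have "card (F1 \<union> F2) < card E"
    using card_Un_le[of F1 F2] F1 F2 assms by simp
  moreover have "finite (F1 \<union> F2)"
    using finite_E F1 F2 by (meson Diff_subset finite_subset finite_UnI subset_trans)
  ultimately obtain e where e: "e \<in> E" "e \<notin> F1" "e \<notin> F2"
    by (meson UnCI card_mono leD subsetI)
  obtain a b where ab: "e = {a, b}" using edge_ends e by blast
  have "reachable (E - {{a, b}} - {f}) a b" for f
  proof (cases "f \<in> F1")
    case True
    then show ?thesis
      using F2 e ab by (intro reachable_mono[OF F2(3)]) auto
  next
    case False
    then show ?thesis
      using F1 e ab by (intro reachable_mono[OF F1(3)]) auto
  qed
  with e ab show ?thesis by blast
qed

section \<open>Cuts of a connected graph\<close>

text \<open>In a connected graph this is the far side of the bridge \<open>f\<close> as seen from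
  \<open>v\<close>, and empty if \<open>f\<close> is no bridge.\<close>

definition cut :: "'a set \<Rightarrow> 'a set set \<Rightarrow> 'a set \<Rightarrow> 'a \<Rightarrow> 'a set" where
  "cut V E f v = {w \<in> V. \<not> reachable (E - {f}) v w}"

locale connected_graph = finite_graph +
  assumes connected: "graph_connected V E"
begin

lemma reachable_in_V: "u \<in> V \<Longrightarrow> w \<in> V \<Longrightarrow> reachable E u w"
  using connected by (simp add: graph_connected_def)

lemma finite_cut [simp]: "finite (cut V E f v)"
  by (simp add: cut_def finite_V)

lemma cut_subset: "cut V E f v \<subseteq> V"
  by (auto simp: cut_def)

lemma card_cut_le: "card (cut V E f v) \<le> card V"
  by (simp add: card_mono cut_subset finite_V)

lemma relevance_eq: "v \<in> V \<Longrightarrow> relevance V E f v = card (cut V E f v)"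
  unfolding relevance_def cut_def by (rule arg_cong[where f = card]) (auto simp: reachable_in_V)

text \<open>Without \<open>f\<close> every vertex is joined to an end of \<open>f\<close>, so there
  are at most two components, and whatever is not joined to \<open>u\<close> lies in the other
  one.\<close>

lemma two_sides:
  assumes "f \<in> E" "u \<in> V" "w \<in> V" "w' \<in> V"
    and "\<not> reachable (E - {f}) u w" "\<not> reachable (E - {f}) u w'"
  shows "reachable (E - {f}) w w'"
proof -
  obtain p q where pq: "p \<in> V" "q \<in> V" "f = {p, q}" using edge_ends assms(1) by blast
  have side: "reachable (E - {f}) p z \<or> reachable (E - {f}) q z" if "z \<in> V" for z
    using reachable_remove_edge[of E p z q] reachable_in_V that pq by auto
  have join: "reachable (E - {f}) z z'" if "reachable (E - {f}) t z" "reachable (E - {f}) t z'" for t z z'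
    using that reachable_sym reachable_trans by metis
  show ?thesis
    using side[OF assms(2)] side[OF assms(3)] side[OF assms(4)] assms(5,6) join by metis
qed

lemma cut_cong: "reachable (E - {f}) u v \<Longrightarrow> cut V E f u = cut V E f v"
  unfolding cut_def by (intro Collect_cong) (meson reachable_sym reachable_trans)

lemma cut_compl:
  assumes "f \<in> E" "u \<in> V" "v \<in> V" "\<not> reachable (E - {f}) u v"
  shows "cut V E f v = V - cut V E f u"
proof -
  have "\<not> reachable (E - {f}) v w \<longleftrightarrow> reachable (E - {f}) u w" if "w \<in> V" for w
    using two_sides[OF assms(1,2,3) that] assms(4) by (meson reachable_sym reachable_trans)
  then show ?thesis by (auto simp: cut_def)
qed

text \<open>Each vertex on the side of \<open>u\<close> loses the far side and each vertex of the
  far side loses the rest, hence the factor 2.\<close>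

lemma separation_eq:
  assumes "f \<in> E" "u \<in> V"
  shows "separation V E f = 2 * card (cut V E f u) * (card V - card (cut V E f u))"
proof -
  let ?D = "cut V E f u"
  have "separation V E f = (\<Sum>v\<in>V. card (cut V E f v))"
    unfolding separation_def by (intro sum.cong) (auto simp: relevance_eq)
  also have "\<dots> = (\<Sum>v\<in>V - ?D. card (cut V E f v)) + (\<Sum>v\<in>?D. card (cut V E f v))"
    by (rule sum.subset_diff) (simp_all add: cut_subset finite_V)
  also have "(\<Sum>v\<in>V - ?D. card (cut V E f v)) = (\<Sum>v\<in>V - ?D. card ?D)"
    by (intro sum.cong) (auto simp: cut_def[of V E f u] dest: cut_cong)
  also have "(\<Sum>v\<in>?D. card (cut V E f v)) = (\<Sum>v\<in>?D. card (V - ?D))"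
    using cut_compl[OF assms] by (intro sum.cong) (auto simp: cut_def[of V E f u])
  finally show ?thesis
    by (simp add: card_Diff_subset cut_subset)
qed

end

section \<open>The risk under the smart adversary\<close>

text \<open>The finite branch of \<open>disconnection_cost\<close>, taken as a real so that averages
  can be estimated outside \<open>ereal\<close>.\<close>

definition risk :: "'a set \<Rightarrow> 'a set set \<Rightarrow> 'a \<Rightarrow> real" where
  "risk V E v = 1 / real (card (max_sep_edges V E)) *
     (\<Sum>e\<in>max_sep_edges V E. real (relevance V E e v))"

context finite_graph
begin

lemma finite_max_sep_edges: "finite (max_sep_edges V E)"
  by (simp add: max_sep_edges_def finite_E)

lemma max_sep_edges_nonempty:
  assumes "E \<noteq> {}"
  shows "max_sep_edges V E \<noteq> {}"
proof -
  have "sep_max V E \<in> separation V E ` E"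
    unfolding sep_max_def using assms finite_E by (intro Max_in) auto
  then show ?thesis by (auto simp: max_sep_edges_def)
qed

lemma separation_le_sep_max: "f \<in> E \<Longrightarrow> separation V E f \<le> sep_max V E"
  unfolding sep_max_def by (simp add: finite_E)

lemma relevance_le_separation: "v \<in> V \<Longrightarrow> relevance V E f v \<le> separation V E f"
  unfolding separation_def using finite_V by (intro member_le_sum) auto

lemma risk_nonneg: "0 \<le> risk V E v"
  by (simp add: risk_def sum_nonneg)

lemma risk_le:
  assumes "\<And>f. f \<in> max_sep_edges V E \<Longrightarrow> real (relevance V E f v) \<le> M" and "0 \<le> M"
  shows "risk V E v \<le> M"
proof (cases "max_sep_edges V E = {}")
  case False
  then have "0 < card (max_sep_edges V E)" by (simp add: finite_max_sep_edges card_gt_0_iff)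
  moreover have "(\<Sum>e\<in>max_sep_edges V E. real (relevance V E e v)) \<le> real (card (max_sep_edges V E)) * M"
    using assms by (intro sum_bounded_above)
  ultimately show ?thesis by (simp add: risk_def field_simps)
\<comment> \<open>With no edge to remove, the risk is an empty sum, and \<open>0 \<le> M\<close>
  suffices.\<close>
qed (simp add: risk_def assms)

lemma risk_ge:
  assumes "E \<noteq> {}" and "\<And>f. f \<in> max_sep_edges V E \<Longrightarrow> M \<le> real (relevance V E f v)"
  shows "M \<le> risk V E v"
proof -
  have "0 < card (max_sep_edges V E)"
    using max_sep_edges_nonempty[OF assms(1)] by (simp add: finite_max_sep_edges card_gt_0_iff)
  moreover have "(\<Sum>e\<in>max_sep_edges V E. real (relevance V E e v)) \<ge> real (card (max_sep_edges V E)) * M"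
    using assms by (intro sum_bounded_below)
  ultimately show ?thesis by (simp add: risk_def field_simps)
qed

text \<open>Exchanging the sums collects the relevances of each worst edge into its separation. All
  worst edges share the value \<open>sep_max V E\<close>, so averaging returns it.\<close>

lemma sum_risk:
  assumes "E \<noteq> {}"
  shows "(\<Sum>v\<in>V. risk V E v) = real (sep_max V E)"
proof -
  let ?M = "max_sep_edges V E"
  have pos: "0 < card ?M"
    using max_sep_edges_nonempty[OF assms] by (simp add: finite_max_sep_edges card_gt_0_iff)
  have "(\<Sum>v\<in>V. \<Sum>e\<in>?M. real (relevance V E e v)) = (\<Sum>e\<in>?M. \<Sum>v\<in>V. real (relevance V E e v))"
    by (rule sum.swap)
  also have "\<dots> = (\<Sum>e\<in>?M. real (sep_max V E))"
    by (intro sum.cong) (auto simp: max_sep_edges_def separation_def simp flip: of_nat_sum)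
  finally show ?thesis
    using pos by (simp add: risk_def flip: sum_divide_distrib)
qed

end

section \<open>Edge counts, and the effect of deleting or adding an edge\<close>

context connected_graph
begin

text \<open>A vertex set grown from \<open>r\<close> gains an inner edge with each new vertex. A
  largest set of this kind is closed under adjacency, so by connectedness it is all of
  \<open>V\<close>.\<close>

lemma card_V_le: "card V \<le> card E + 1"
proof (cases "V = {}")
  case False
  then obtain r where r: "r \<in> V" by blast
  define P where "P U \<longleftrightarrow> U \<subseteq> V \<and> r \<in> U \<and> card U \<le> card {e \<in> E. e \<subseteq> U} + 1" for U
  have "P {r}" using r by (simp add: P_def)
  moreover have "\<forall>U. P U \<longrightarrow> card U < card V + 1"
    by (simp add: P_def card_mono finite_V less_Suc_eq_le)
  ultimately have "\<exists>U. P U \<and> (\<forall>U'. P U' \<longrightarrow> card U' \<le> card U)"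
    by (rule Lattices_Big.ex_has_greatest_nat)
  then obtain U where U: "P U" and max: "\<And>U'. P U' \<Longrightarrow> card U' \<le> card U"
    by metis
  have finU: "finite U" using U finite_V by (auto simp: P_def intro: finite_subset)
  have closed: "w \<in> U" if "u \<in> U" "{u, w} \<in> E" for u w
  proof (rule ccontr)
    assume w: "w \<notin> U"
    \<comment> \<open>The edge \<open>{u, w}\<close> was not inside \<open>U\<close>, so it makes up
      for the added vertex \<open>w\<close>.\<close>
    have "insert {u, w} {e \<in> E. e \<subseteq> U} \<subseteq> {e \<in> E. e \<subseteq> insert w U}"
      using that by auto
    then have "card (insert {u, w} {e \<in> E. e \<subseteq> U}) \<le> card {e \<in> E. e \<subseteq> insert w U}"
      by (intro card_mono) (simp_all add: finite_E)
    then have "card {e \<in> E. e \<subseteq> U} + 1 \<le> card {e \<in> E. e \<subseteq> insert w U}"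
      using w by (simp add: finite_E)
    then have "P (insert w U)"
      using U w finU ends_in_V[OF that(2)] by (auto simp: P_def)
    from max[OF this] show False using w finU by simp
  qed
  have "w \<in> U" if "reachable E r w" for w
    using that by (induction rule: reachable_induct) (use U closed in \<open>auto simp: P_def\<close>)
  then have "V \<subseteq> U" using reachable_in_V r by blast
  then have "card V \<le> card U" using finU by (intro card_mono)
  also have "\<dots> \<le> card {e \<in> E. e \<subseteq> U} + 1" using U by (simp add: P_def)
  also have "card {e \<in> E. e \<subseteq> U} \<le> card E" by (intro card_mono) (auto simp: finite_E)
  finally show ?thesis by simp
qed simp

lemma connected_remove:
  assumes "{a, b} \<in> E" "reachable (E - {{a, b}}) a b"
  shows "connected_graph V (E - {{a, b}})"
proof
  show "graph_connected V (E - {{a, b}})"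
    unfolding graph_connected_def
  proof (intro ballI)
    fix u w assume "u \<in> V" "w \<in> V"
    from reachable_in_V[OF this] show "reachable (E - {{a, b}}) u w"
    proof (rule reachable_lift)
      fix p q assume pq: "{p, q} \<in> E"
      show "reachable (E - {{a, b}}) p q"
      proof (cases "{p, q} = {a, b}")
        case True
        then show ?thesis using assms(2) reachable_sym[OF assms(2)] by (auto simp: doubleton_eq_iff)
      next
        case False
        then show ?thesis using pq by (intro reachable_edge) auto
      qed
    qed
  qed
qed (use finite_V edge_ends in auto)

text \<open>Every edge is a bridge here, since deleting a non-bridge would leave a connected graph
  with too few edges. The product of the sizes of the two sides is least when one side is a single
  vertex.\<close>

lemma tree_separation:
  assumes "card E + 1 = card V" "f \<in> E"
  shows "2 * (card V - 1) \<le> separation V E f"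
proof -
  obtain a b where ab: "a \<in> V" "b \<in> V" "f = {a, b}" using edge_ends assms(2) by blast
  have "\<not> reachable (E - {f}) a b"
  proof
    assume "reachable (E - {f}) a b"
    then interpret G: connected_graph V "E - {{a, b}}"
      using connected_remove assms(2) ab by simp
    show False
      using G.card_V_le assms finite_E ab card_gt_0_iff[of E] by (auto simp: card_Diff_singleton)
  qed
  then have "b \<in> cut V E f a" "a \<notin> cut V E f a" using ab by (auto simp: cut_def)
  then have c: "0 < card (cut V E f a)" "card (cut V E f a) < card V"
    using ab cut_subset by (auto simp: card_gt_0_iff intro!: psubset_card_mono finite_V)
  define c d where "c = card (cut V E f a)" and "d = card V - c"
  have "1 \<le> c" "1 \<le> d" using c by (auto simp: c_def d_def)
  \<comment> \<open>This is \<open>(c - 1) * (d - 1) \<ge> 0\<close>.\<close>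
  then have "c + d \<le> c * d + 1"
    by (cases c; cases d) auto
  moreover have "card V = c + d" using c by (auto simp: c_def d_def)
  moreover have "separation V E f = 2 * (c * d)"
    using separation_eq[OF assms(2) ab(1)] by (simp add: c_def d_def)
  ultimately show ?thesis by simp
qed

text \<open>Since \<open>a\<close> and \<open>b\<close> stay joined whatever further edge fails,
  every cut, and with it every relevance and separation, is as before. Only the set of worst edges
  needs care.\<close>

lemma risk_remove:
  assumes "{a, b} \<in> E" "\<And>f. reachable (E - {{a, b}} - {f}) a b" "v \<in> V"
  shows "risk V (E - {{a, b}}) v \<le> risk V E v"
proof -
  let ?e = "{a, b}"
  have "reachable (E - {?e}) a b"
    using assms(2)[of ?e] by simp
  then interpret G: connected_graph V "E - {?e}"
    using connected_remove assms(1) by blast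
  have same: "reachable (E - {?e} - {f}) u w \<longleftrightarrow> reachable (E - {f}) u w" for f u w
  proof
    assume "reachable (E - {f}) u w"
    then show "reachable (E - {?e} - {f}) u w"
    proof (rule reachable_lift)
      fix p q assume pq: "{p, q} \<in> E - {f}"
      show "reachable (E - {?e} - {f}) p q"
      proof (cases "{p, q} = ?e")
        case True
        then show ?thesis using assms(2)[of f] reachable_sym[OF assms(2)[of f]] by (auto simp: doubleton_eq_iff)
      next
        case False
        then show ?thesis using pq by (intro reachable_edge) auto
      qed
    qed
  qed (rule reachable_mono, auto)
  have rel: "relevance V (E - {?e}) f u = relevance V E f u" if "u \<in> V" for f u
    using that by (simp add: relevance_eq G.relevance_eq cut_def same)
  then have sep: "separation V (E - {?e}) f = separation V E f" for f
    by (simp add: separation_def)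
  have "cut V E ?e u = {}" if "u \<in> V" for u
    using that G.reachable_in_V by (auto simp: cut_def)
  then have "relevance V E ?e u = 0" if "u \<in> V" for u
    using that by (simp add: relevance_eq)
  then have sep_e: "separation V E ?e = 0"
    by (simp add: separation_def)
  show ?thesis
  proof (cases "sep_max V E = 0")
    case True
    \<comment> \<open>All edges are worst here, including the deleted one, so the set of worst edges
      does change; but without bridges the risk is 0.\<close>
    have "relevance V (E - {?e}) f v \<le> 0" if "f \<in> E" for f
      using relevance_le_separation[OF assms(3)] separation_le_sep_max[OF that] True rel assms(3)
      by (metis le_trans)
    then have "risk V (E - {?e}) v \<le> 0"
      by (intro G.risk_le) (auto simp: max_sep_edges_def)
    then show ?thesis using risk_nonneg[of v] by linarith
  next
    case False
    obtain f where f: "f \<in> E" "separation V E f = sep_max V E"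
      using max_sep_edges_nonempty assms(1) by (auto simp: max_sep_edges_def)
    \<comment> \<open>A worst edge of positive separation is not the deleted one, so the maximum is
      still attained.\<close>
    have "f \<noteq> ?e" using f False sep_e by auto
    then have "sep_max V (E - {?e}) = sep_max V E"
      unfolding sep_max_def[of V "E - {?e}"] using f sep separation_le_sep_max finite_E
      by (intro Max_eqI) (auto intro!: image_eqI[of _ _ f])
    then have "max_sep_edges V (E - {?e}) = max_sep_edges V E"
      using False sep_e by (auto simp: max_sep_edges_def sep)
    then show ?thesis by (simp add: risk_def rel assms(3))
  qed
qed

text \<open>The new edge closes a cycle, so it is no bridge, and neither is any edge that separated
  \<open>a\<close> from \<open>b\<close>. All other cuts from \<open>a\<close> can only shrink. As
  \<open>M\<close> bounds the relevance of every edge, it does not matter which ones are worst in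
  the new graph.\<close>

lemma risk_insert:
  assumes "a \<in> V" "b \<in> V" "a \<noteq> b" "{a, b} \<notin> E" "0 \<le> M"
    and M: "\<And>f. f \<in> E \<Longrightarrow> reachable (E - {f}) a b \<Longrightarrow> real (card (cut V E f a)) \<le> M"
  shows "risk V (insert {a, b} E) a \<le> M"
proof -
  let ?E' = "insert {a, b} E"
  interpret G: connected_graph V ?E'
  proof
    show "graph_connected V ?E'"
      using connected unfolding graph_connected_def by (blast intro: reachable_mono)
  qed (use finite_V edge_ends assms in auto)
  show ?thesis
  proof (rule G.risk_le)
    fix f assume "f \<in> max_sep_edges V ?E'"
    then have f: "f \<in> ?E'" by (simp add: max_sep_edges_def)
    show "real (relevance V ?E' f a) \<le> M"
    proof (cases "f \<in> E \<and> reachable (E - {f}) a b")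
      case True
      have "cut V ?E' f a \<subseteq> cut V E f a"
        by (auto simp: cut_def dest: reachable_mono[where E' = "?E' - {f}"])
      then have "card (cut V ?E' f a) \<le> card (cut V E f a)"
        by (simp add: card_mono)
      then show ?thesis using M[of f] True by (simp add: G.relevance_eq assms(1))
    next
      case False
      have "reachable (?E' - {f}) a w" if w: "w \<in> V" for w
      proof (cases "f \<in> E")
        case True
        then have "reachable (E - {f}) a w \<or> reachable (E - {f}) b w"
          using False two_sides[OF True assms(1,2) w] by blast
        moreover have "reachable (?E' - {f}) a b"
          using True assms(4) by (intro reachable_edge) auto
        ultimately show ?thesis
          by (blast intro: reachable_mono reachable_trans)
      next
        case False
        then show ?thesis using f reachable_in_V[OF assms(1) w] assms(4)
          by (simp add: insert_Diff_if)
      qed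
      then have "cut V ?E' f a = {}" by (auto simp: cut_def)
      then show ?thesis by (simp add: G.relevance_eq assms(1) assms(5))
    qed
  qed fact
qed

section \<open>Nested cuts and the choice of a new edge\<close>

lemma cuts_nested:
  assumes "f \<in> E" "g \<in> E" "x \<in> V" "z \<in> cut V E f x" "z \<in> cut V E g x"
  shows "cut V E f x \<subseteq> cut V E g x \<or> cut V E g x \<subseteq> cut V E f x"
proof (cases "f = g")
  case False
  obtain r s where rs: "r \<in> V" "s \<in> V" "g = {r, s}" using edge_ends assms(2) by blast
  have step: "reachable (E - {f}) r s"
    using False assms(2) rs by (intro reachable_edge) auto
  \<comment> \<open>Both ends of \<open>g\<close> lie on one side of \<open>f\<close>. If they lie
    beyond \<open>f\<close>, the side of \<open>x\<close> stays joined without \<open>g\<close>, so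
    \<open>g\<close> cuts off only vertices beyond \<open>f\<close>. Otherwise the far side of
    \<open>f\<close> stays joined without \<open>g\<close> and follows its member \<open>z\<close>
    into the cut of \<open>g\<close>.\<close>
  show ?thesis
  proof (cases "r \<in> cut V E f x")
    case True
    then have g: "\<not> reachable (E - {f}) x r" "\<not> reachable (E - {f}) x s"
      using reachable_eq'[OF step, of x] True by (auto simp: cut_def)
    have "w \<notin> cut V E g x" if "w \<in> V" "w \<notin> cut V E f x" for w
    proof -
      have "reachable (E - {g}) x w"
        by (rule reachable_avoid[of E f]) (use that g rs in \<open>auto simp: cut_def\<close>)
      then show ?thesis by (simp add: cut_def)
    qed
    then show ?thesis using cut_subset by blast
  next
    case False
    then have g: "reachable (E - {f}) x r" "reachable (E - {f}) x s"
      using rs reachable_trans[OF _ step, of x] by (auto simp: cut_def)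
    have "w \<in> cut V E g x" if w: "w \<in> cut V E f x" for w
    proof -
      have "reachable (E - {f}) z w"
        using two_sides[OF assms(1) assms(3)] assms(4) w by (auto simp: cut_def)
      moreover have "\<not> reachable (E - {f}) z t" if "t \<in> g" for t
      proof
        assume "reachable (E - {f}) z t"
        moreover have "reachable (E - {f}) x t" using that g rs by auto
        ultimately have "reachable (E - {f}) x z" by (simp add: reachable_eq')
        with assms(4) show False by (simp add: cut_def)
      qed
      ultimately have "reachable (E - {g}) z w" by (rule reachable_avoid)
      then show ?thesis
        using assms(5) w reachable_eq'[of "E - {g}" z w x] by (auto simp: cut_def)
    qed
    then show ?thesis by blast
  qed
qed simp

text \<open>Two cuts that each contain more than half of \<open>A\<close> meet, hence are nested; so the cuts of this
  kind form a chain, whose least element lies in all of them.\<close>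

lemma heavy_vertex:
  assumes "A \<noteq> {}" "A \<subseteq> V" "x \<in> V"
  shows "\<exists>a\<in>A. \<forall>f\<in>E. cut V E f x \<subseteq> A \<and> card A < 2 * card (cut V E f x) \<longrightarrow> a \<in> cut V E f x"
proof -
  define H where "H = {f \<in> E. cut V E f x \<subseteq> A \<and> card A < 2 * card (cut V E f x)}"
  have finA: "finite A" using assms finite_V finite_subset by blast
  show ?thesis
  proof (cases "H = {}")
    case True
    then show ?thesis using assms(1) by (auto simp: H_def)
  next
    case False
    then obtain f where f: "f \<in> H" and min: "\<And>g. g \<in> H \<Longrightarrow> card (cut V E f x) \<le> card (cut V E g x)"
      using ex_has_least_nat[of "\<lambda>f. f \<in> H" _ "\<lambda>f. card (cut V E f x)"] by blast
    have "cut V E f x \<subseteq> cut V E g x" if g: "g \<in> H" for g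
    proof -
      let ?F = "cut V E f x" and ?G = "cut V E g x"
      have "card (?F \<union> ?G) \<le> card A"
        using f g finA by (intro card_mono) (auto simp: H_def)
      moreover have "card ?F + card ?G = card (?F \<union> ?G) + card (?F \<inter> ?G)"
        by (intro card_Un_Int) simp_all
      ultimately have "card (?F \<inter> ?G) \<noteq> 0"
        using f g by (auto simp: H_def)
      then obtain z where "z \<in> ?F" "z \<in> ?G" by (metis IntE card.empty equals0I)
      then have "?F \<subseteq> ?G \<or> ?G \<subseteq> ?F"
        using f g assms(3) by (intro cuts_nested) (auto simp: H_def)
      \<comment> \<open>The cut of \<open>f\<close> has least size, so inclusion in the wrong
        direction is equality.\<close>
      then show ?thesis using min[OF g] by (metis card_seteq finite_cut subset_refl)
    qed
    moreover obtain a where "a \<in> cut V E f x"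
      using f by (auto simp: H_def) (metis card.empty equals0I mult_0_right not_less_zero)
    moreover have "cut V E f x \<subseteq> A" using f by (simp add: H_def)
    ultimately show ?thesis by (auto simp: H_def)
  qed
qed

text \<open>Some end of \<open>f\<close> is joined to \<open>v\<close> without \<open>f\<close>. If
  both were, every vertex would be, and nothing would be cut off.\<close>

lemma bridge_ends:
  assumes "f \<in> E" "v \<in> V" "cut V E f v \<noteq> {}"
  shows "\<exists>x\<in>V. \<exists>y\<in>V. f = {x, y} \<and> reachable (E - {f}) v x \<and> y \<in> cut V E f v"
proof -
  have ends: ?thesis if pq: "p \<in> V" "q \<in> V" "f = {p, q}" and vp: "reachable (E - {f}) v p" for p q
  proof (rule ccontr)
    assume "\<not> ?thesis"
    with that have vq: "reachable (E - {f}) v q" by (auto simp: cut_def)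
    have "reachable (E - {f}) v z" if "z \<in> V" for z
      using reachable_remove_edge[of E p z q] reachable_in_V[OF pq(1) that] pq(3)
        reachable_trans[OF vp, of z] reachable_trans[OF vq, of z] by auto
    with assms(3) show False by (auto simp: cut_def)
  qed
  obtain p q where pq: "p \<in> V" "q \<in> V" "f = {p, q}" using edge_ends assms(1) by blast
  then consider "reachable (E - {f}) v p" | "reachable (E - {f}) v q"
    using reachable_remove_edge[of E p v q] reachable_in_V[OF pq(1) assms(2)]
      reachable_sym[of _ _ v] by blast
  then show ?thesis
    by cases (use ends[of p q] ends[of q p] pq in \<open>auto simp: insert_commute\<close>)
qed

text \<open>A new edge between the two sides of the bridge \<open>e\<close> closes a cycle through \<open>e\<close>. What an edge
  \<open>f\<close> off this cycle cuts off lies on one side of \<open>e\<close> and avoids the ends of \<open>e\<close> and of the new edge.\<close>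

lemma new_edge_across_bridge:
  assumes "e \<in> E" "v \<in> V" "cut V E e v \<noteq> {}"
  shows "\<exists>x\<in>V. \<exists>y \<in> cut V E e v. \<forall>a \<in> V - cut V E e v. \<forall>b \<in> cut V E e v - {y}.
           {a, b} \<notin> E \<and> (\<forall>f\<in>E. reachable (E - {f}) a b \<longrightarrow> cut V E f a = cut V E f x \<and>
             (cut V E f x \<subseteq> V - cut V E e v - {a} \<or> cut V E f x \<subseteq> cut V E e v - {y} - {b}))"
proof -
  obtain x y where xy: "x \<in> V" "y \<in> V" "e = {x, y}" "reachable (E - {e}) v x" "y \<in> cut V E e v"
    using bridge_ends[OF assms] by blast
  have cut_x: "cut V E e v = cut V E e x" by (rule cut_cong[OF xy(4)])
  show ?thesis
    unfolding cut_x
  proof (rule bexI[of _ x], rule bexI[of _ y], intro ballI conjI impI)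
    fix a b assume a: "a \<in> V - cut V E e x" and b: "b \<in> cut V E e x - {y}"
    have xa: "reachable (E - {e}) x a" and xb: "\<not> reachable (E - {e}) x b" "b \<in> V" "b \<noteq> y"
      using a b by (auto simp: cut_def)
    have xy': "\<not> reachable (E - {e}) x y" using xy(5) unfolding cut_x by (simp add: cut_def)
    have ab: "\<not> reachable (E - {e}) a b"
      using xa xb reachable_trans by metis
    show "{a, b} \<notin> E"
    proof
      assume "{a, b} \<in> E"
      \<comment> \<open>Excluding \<open>y\<close> from the choice of \<open>b\<close> rules out
        \<open>e\<close> itself; any other edge between the sides would join them without
        \<open>e\<close>.\<close>
      moreover have "{a, b} \<noteq> e"
        using xa xy' xb xy(3) by (auto simp: doubleton_eq_iff)
      ultimately have "reachable (E - {e}) a b" by (intro reachable_edge) auto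
      with ab show False ..
    qed
    fix f assume f: "f \<in> E" and fab: "reachable (E - {f}) a b"
    then have fe: "f \<noteq> e" using ab by auto
    obtain p q where pq: "p \<in> V" "q \<in> V" "f = {p, q}" using edge_ends f by blast
    have epq: "reachable (E - {e}) p q" using pq f fe by (intro reachable_edge) auto
    have fxy: "reachable (E - {f}) x y" using xy fe assms(1) by (intro reachable_edge) auto
    have key: "reachable (E - {f}) x a \<and> reachable (E - {f}) x b \<and>
      (cut V E f x \<subseteq> V - cut V E e x \<or> cut V E f x \<subseteq> cut V E e x - {y})"
    proof (cases "reachable (E - {e}) x p")
      case True
      then have xq: "reachable (E - {e}) x q" using epq by (rule reachable_trans)
      \<comment> \<open>\<open>f\<close> lies on the side of \<open>x\<close>: the far side of
        \<open>e\<close> is unharmed, and \<open>x\<close> reaches it through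
        \<open>e\<close>.\<close>
      have "reachable (E - {f}) x w" if w: "w \<in> cut V E e x" for w
      proof -
        have "reachable (E - {e}) y w"
          using two_sides[OF assms(1) xy(1,2) _ xy'] w by (simp add: cut_def)
        moreover have "\<not> reachable (E - {e}) y t" if "t \<in> f" for t
          using that pq(3) reachable_eq[of "E - {e}" y t x] reachable_sym[OF True] reachable_sym[OF xq]
            reachable_sym[of _ y x] xy' by auto
        ultimately have "reachable (E - {f}) y w" by (rule reachable_avoid)
        with fxy show ?thesis by (rule reachable_trans)
      qed
      then have "cut V E f x \<subseteq> V - cut V E e x" "reachable (E - {f}) x b"
        using b by (auto simp: cut_def[of V E f])
      moreover have "reachable (E - {f}) x a"
        using fab \<open>reachable (E - {f}) x b\<close> reachable_sym reachable_trans by metis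
      ultimately show ?thesis by blast
    next
      case False
      then have xq: "\<not> reachable (E - {e}) x q" using epq reachable_sym reachable_trans by metis
      \<comment> \<open>\<open>f\<close> lies beyond \<open>e\<close>: the side of \<open>x\<close>
        is unharmed, and \<open>y\<close> is reached through \<open>e\<close>.\<close>
      have "reachable (E - {f}) x w" if w: "reachable (E - {e}) x w" for w
        using w by (rule reachable_avoid) (use pq False xq in auto)
      then have "cut V E f x \<subseteq> cut V E e x - {y}" "reachable (E - {f}) x a"
        using xa fxy by (auto simp: cut_def)
      moreover have "reachable (E - {f}) x b"
        using \<open>reachable (E - {f}) x a\<close> fab by (rule reachable_trans)
      ultimately show ?thesis by blast
    qed
    then show "cut V E f a = cut V E f x" using cut_cong by metis
    have "a \<notin> cut V E f x" "b \<notin> cut V E f x" using key by (auto simp: cut_def)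
    then show "cut V E f x \<subseteq> V - cut V E e x - {a} \<or> cut V E f x \<subseteq> cut V E e x - {y} - {b}"
      using key by blast
  qed (use xy cut_x in auto)
qed

end

text \<open>Over the integers, equal sums give \<open>(c - s) * (d - s) = c * d - s * t\<close>,
  which is not positive here. For cuts: an edge no worse than the worst one has a side of size at
  most \<open>s\<close>.\<close>

lemma balanced_product_le:
  fixes c d s t :: nat
  assumes "c + d = s + t" "s \<le> t" "c * d \<le> s * t"
  shows "c \<le> s \<or> d \<le> s"
proof (rule ccontr)
  assume "\<not> (c \<le> s \<or> d \<le> s)"
  then have "0 < (int c - int s) * (int d - int s)" by (intro mult_pos_pos) auto
  moreover have t: "int t = int c + int d - int s" using assms(1) by linarith
  have "int c * int d \<le> int s * int t" using assms(3) by (metis of_nat_le_iff of_nat_mult)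
  ultimately show False unfolding t by (simp add: algebra_simps)
qed

lemma balanced_product_eq:
  fixes c d s t :: nat
  assumes "c + d = s + t" "c * d = s * t"
  shows "c = s \<or> c = t"
proof -
  have t: "int t = int c + int d - int s" using assms(1) by linarith
  have "int c * int d = int s * int t" using assms(2) by (metis of_nat_mult)
  then have "(int c - int s) * (int d - int s) = 0" unfolding t by (simp add: algebra_simps)
  then show ?thesis using assms(1) by auto
qed

section \<open>Separation in graphs that are stable under adding an edge\<close>

text \<open>\<open>stable\<close> says that no vertex gains by buying one edge at price
  \<open>\<alpha>\<close>. With \<open>n = card V\<close>, the constant 6 comes from unbalanced
  worst cuts, \<open>5 * s < 2 * n\<close>, where
  \<open>\<alpha> * n \<ge> s * (t - s) \<ge> s * t / 3\<close>; balanced ones give 5.\<close>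

lemma (in connected_graph) sep_max_le:
  assumes "3 \<le> card V" "0 < \<alpha>"
    and stable: "\<And>a b. a \<in> V \<Longrightarrow> b \<in> V \<Longrightarrow> a \<noteq> b \<Longrightarrow> {a, b} \<notin> E \<Longrightarrow>
      risk V E a \<le> \<alpha> + risk V (insert {a, b} E) a"
  shows "real (sep_max V E) \<le> 6 * \<alpha> * real (card V)"
proof (cases "sep_max V E = 0")
  case False
  let ?n = "card V"
  have E: "E \<noteq> {}" using card_V_le assms(1) by auto
  have V: "V \<noteq> {}" using assms(1) by auto
  then obtain u where u: "u \<in> V" by blast
  obtain e0 where e0: "e0 \<in> E" "separation V E e0 = sep_max V E"
    using max_sep_edges_nonempty[OF E] by (auto simp: max_sep_edges_def)
  define s t where "s = min (card (cut V E e0 u)) (?n - card (cut V E e0 u))"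
    and "t = max (card (cut V E e0 u)) (?n - card (cut V E e0 u))"
  have st: "s + t = ?n" "s \<le> t"
    using card_cut_le[of e0 u] by (auto simp: s_def t_def)
  have sep: "sep_max V E = 2 * s * t"
    using separation_eq[OF e0(1) u] e0(2) by (auto simp: s_def t_def min_def max_def)
  have s: "0 < s" using False sep by (cases s) auto
  have t2: "2 \<le> t" using st assms(1) by linarith
  \<comment> \<open>No edge cuts off a number of vertices strictly between \<open>s\<close> and
    \<open>t\<close>, as its separation would exceed the maximum.\<close>
  have cut_le: "card (cut V E f v) \<le> s \<or> t \<le> card (cut V E f v)" if "f \<in> E" "v \<in> V" for f v
  proof -
    have "card (cut V E f v) * (?n - card (cut V E f v)) \<le> s * t"
      using separation_le_sep_max[OF that(1)] separation_eq[OF that] sep by simp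
    then have "card (cut V E f v) \<le> s \<or> ?n - card (cut V E f v) \<le> s"
      using st card_cut_le[of f v] by (intro balanced_product_le) auto
    then show ?thesis using st by auto
  qed
  have cut_eq: "card (cut V E f v) = s \<or> card (cut V E f v) = t" if "f \<in> max_sep_edges V E" "v \<in> V" for f v
  proof -
    have f: "f \<in> E" "separation V E f = sep_max V E" using that by (auto simp: max_sep_edges_def)
    have "card (cut V E f v) * (?n - card (cut V E f v)) = s * t"
      using f separation_eq[OF f(1) that(2)] sep by simp
    then show ?thesis
      using st card_cut_le[of f v] by (intro balanced_product_eq) auto
  qed
  \<comment> \<open>Whichever worst edge is removed, \<open>v\<close> loses at least the smaller
    side.\<close>
  have risk_s: "real s \<le> risk V E v" if "v \<in> V" for v
    using cut_eq[OF _ that] st(2) by (intro risk_ge E) (fastforce simp: relevance_eq that)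
  have deviation: "risk V E a \<le> \<alpha> + M"
    if e: "e \<in> E" "v \<in> V" "card (cut V E e v) = t" and ab: "a \<in> V - cut V E e v" "b \<in> cut V E e v"
      "{a, b} \<notin> E" "0 \<le> M"
      "\<And>f. f \<in> E \<Longrightarrow> reachable (E - {f}) a b \<Longrightarrow> real (card (cut V E f a)) \<le> M" for e v a b M
  proof -
    have "a \<in> V" "b \<in> V" "a \<noteq> b" using ab cut_subset by blast+
    then show ?thesis
      using stable[of a b] risk_insert[of a b M] ab by force
  qed
  have sides: "card (V - cut V E e v) = s" "card (cut V E e v - {y}) + 1 = t"
    "cut V E e v - {y} \<noteq> {}" "cut V E e v \<noteq> {}"
    if "card (cut V E e v) = t" "y \<in> cut V E e v" for e v y
  proof -
    show "card (V - cut V E e v) = s"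
      using that st by (simp add: card_Diff_subset cut_subset)
    show y: "card (cut V E e v - {y}) + 1 = t"
      using that t2 by (simp add: card_Diff_singleton)
    show "cut V E e v - {y} \<noteq> {}"
    proof
      assume "cut V E e v - {y} = {}"
      with y t2 show False by simp
    qed
    show "cut V E e v \<noteq> {}" using that by blast
  qed
  show ?thesis
  proof (cases "2 * ?n \<le> 5 * s")
    case True
    obtain e where e: "e \<in> max_sep_edges V E" using max_sep_edges_nonempty[OF E] by blast
    then have eE: "e \<in> E" by (simp add: max_sep_edges_def)
    \<comment> \<open>\<open>v\<close> is taken on a side of size \<open>s\<close>, from where the
      worst edge cuts off the other \<open>t\<close> vertices.\<close>
    have "\<exists>v\<in>V. card (cut V E e v) = t"
    proof (cases "card (cut V E e u) = t")
      case False
      then have us: "card (cut V E e u) = s" using cut_eq e u by blast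
      then have "cut V E e u \<noteq> {}" using s by auto
      then obtain w where w: "w \<in> V" "\<not> reachable (E - {e}) u w" by (auto simp: cut_def)
      then have "cut V E e w = V - cut V E e u" using cut_compl[OF eE u] by blast
      then have "card (cut V E e w) = t"
        using us st by (simp add: card_Diff_subset cut_subset)
      then show ?thesis using w by blast
    qed (use u in blast)
    then obtain v where v: "v \<in> V" "card (cut V E e v) = t" by blast
    then have "cut V E e v \<noteq> {}" using t2 by auto
    from new_edge_across_bridge[OF eE v(1) this] obtain x y where x: "x \<in> V" and y: "y \<in> cut V E e v"
      and new: "\<And>a b. a \<in> V - cut V E e v \<Longrightarrow> b \<in> cut V E e v - {y} \<Longrightarrow> {a, b} \<notin> E"
        "\<And>a b f. a \<in> V - cut V E e v \<Longrightarrow> b \<in> cut V E e v - {y} \<Longrightarrow> f \<in> E \<Longrightarrow>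
           reachable (E - {f}) a b \<Longrightarrow> cut V E f a = cut V E f x \<and>
          (cut V E f x \<subseteq> V - cut V E e v - {a} \<or> cut V E f x \<subseteq> cut V E e v - {y} - {b})"
      by blast
    define A B where "A = V - cut V E e v" and "B = cut V E e v - {y}"
    have cards: "card A = s" "card B + 1 = t" "B \<noteq> {}" using sides[OF v(2) y] by (auto simp: A_def B_def)
    then have "A \<noteq> {}" using s by auto
    \<comment> \<open>\<open>a\<close> and \<open>b\<close> are put into all heavy cuts of their
      sides, so every cut that remains after buying \<open>{a, b}\<close> contains at most half of
      its side.\<close>
    then obtain a where a: "a \<in> A"
      "\<And>f. f \<in> E \<Longrightarrow> cut V E f x \<subseteq> A \<Longrightarrow> card A < 2 * card (cut V E f x) \<Longrightarrow> a \<in> cut V E f x"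
      using heavy_vertex[of A x] x by (auto simp: A_def)
    have "B \<subseteq> V" using cut_subset by (auto simp: B_def)
    then obtain b where b: "b \<in> B"
      "\<And>f. f \<in> E \<Longrightarrow> cut V E f x \<subseteq> B \<Longrightarrow> card B < 2 * card (cut V E f x) \<Longrightarrow> b \<in> cut V E f x"
      using heavy_vertex[of B x] x cards(3) by blast
    have "risk V E a \<le> \<alpha> + t / 2"
    proof (rule deviation[OF eE v])
      show "a \<in> V - cut V E e v" "b \<in> cut V E e v" using a b by (auto simp: A_def B_def)
      show "{a, b} \<notin> E" using new(1) a b by (auto simp: A_def B_def)
      fix f assume f: "f \<in> E" "reachable (E - {f}) a b"
      then have c: "cut V E f a = cut V E f x"
        "cut V E f x \<subseteq> A - {a} \<or> cut V E f x \<subseteq> B - {b}"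
        using new(2)[of a b f] a(1) b(1) by (auto simp: A_def B_def)
      then have "2 * card (cut V E f x) \<le> card A \<or> 2 * card (cut V E f x) \<le> card B"
        using a(2)[OF f(1)] b(2)[OF f(1)] by (meson Diff_iff insertI1 not_le_imp_less subset_iff)
      \<comment> \<open>The two sides have \<open>s \<le> t\<close> and \<open>t - 1\<close>
        vertices.\<close>
      then have "2 * card (cut V E f a) \<le> t" using c(1) cards(1,2) st by auto
      then show "real (card (cut V E f a)) \<le> t / 2" by linarith
    qed simp
    moreover have "real s \<le> risk V E a" using a by (intro risk_s) (auto simp: A_def)
    \<comment> \<open>With \<open>s \<ge> 2 * n / 5\<close> this makes \<open>\<alpha>\<close> at
      least \<open>n / 10\<close>; the rest is \<open>s * t \<le> n^2 / 4\<close>.\<close>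
    ultimately have "real s - real t / 2 \<le> \<alpha>" by linarith
    moreover have "real ?n = real s + real t" using st by linarith
    moreover have "2 * real ?n \<le> 5 * real s" using True by linarith
    ultimately have "real ?n \<le> 10 * \<alpha>" by linarith
    then have "real ?n * real ?n \<le> 10 * \<alpha> * real ?n" by (intro mult_right_mono) auto
    moreover have "4 * (real s * real t) \<le> real ?n * real ?n"
      using sum_squares_ge_zero[of "real s - real t" 0] unfolding st(1)[symmetric]
      by (simp add: algebra_simps)
    moreover have "0 \<le> \<alpha> * real ?n" using assms(2) by simp
    ultimately show ?thesis using sep by simp
  next
    case False
    \<comment> \<open>The risks sum to \<open>sep_max V E\<close>, so some vertex bears at least the
      average.\<close>
    have "\<exists>v\<in>V. real (sep_max V E) / ?n \<le> risk V E v"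
    proof (rule ccontr)
      assume "\<not> ?thesis"
      then have "(\<Sum>v\<in>V. risk V E v) < (\<Sum>v\<in>V. real (sep_max V E) / ?n)"
        using finite_V V by (intro sum_strict_mono) auto
      then show False using sum_risk[OF E] assms(1) by simp
    qed
    then obtain v where v: "v \<in> V" "real (sep_max V E) / ?n \<le> risk V E v" by blast
    have n: "real ?n = real s + real t" "0 < real ?n" using st assms(1) by linarith+
    then have sep_v: "2 * (real s * real t) \<le> risk V E v * (real s + real t)"
      using v(2) sep by (simp add: field_simps)
    have small: "3 * real s < 2 * real t" using False n st by linarith
    \<comment> \<open>If every worst edge cut off only \<open>s\<close> vertices from
      \<open>v\<close>, its risk would be at most \<open>s\<close>; but the average
      \<open>2 * s * t / n\<close> exceeds \<open>s\<close> when \<open>s < t\<close>.\<close>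
    have "\<exists>e\<in>max_sep_edges V E. card (cut V E e v) = t"
    proof (rule ccontr)
      assume *: "\<not> ?thesis"
      then have "risk V E v \<le> real s"
        using cut_eq[OF _ v(1)] by (intro risk_le) (fastforce simp: relevance_eq v(1))+
      then have "risk V E v * (real s + real t) \<le> real s * (real s + real t)"
        by (intro mult_right_mono) auto
      then have "real s * (2 * real t) \<le> real s * (real s + real t)" using sep_v by linarith
      then have "2 * real t \<le> real s + real t" using s by simp
      then show False using small by linarith
    qed
    then obtain e where e: "e \<in> E" "card (cut V E e v) = t" by (auto simp: max_sep_edges_def)
    then have "cut V E e v \<noteq> {}" using t2 by auto
    from new_edge_across_bridge[OF e(1) v(1) this] obtain x y where x: "x \<in> V" and y: "y \<in> cut V E e v"
      and new: "\<And>a b. a \<in> V - cut V E e v \<Longrightarrow> b \<in> cut V E e v - {y} \<Longrightarrow> {a, b} \<notin> E"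
        "\<And>a b f. a \<in> V - cut V E e v \<Longrightarrow> b \<in> cut V E e v - {y} \<Longrightarrow> f \<in> E \<Longrightarrow>
           reachable (E - {f}) a b \<Longrightarrow> cut V E f a = cut V E f x \<and>
          (cut V E f x \<subseteq> V - cut V E e v - {a} \<or> cut V E f x \<subseteq> cut V E e v - {y} - {b})"
      by blast
    obtain b where b: "b \<in> cut V E e v - {y}" using sides(3)[OF e(2) y] by blast
    have va: "v \<in> V - cut V E e v" using v by (simp add: cut_def)
    have "risk V E v \<le> \<alpha> + s"
    proof (rule deviation[OF e(1) v(1) e(2) va])
      show "b \<in> cut V E e v" using b by blast
      show "{v, b} \<notin> E" using new(1) va b by blast
      fix f assume f: "f \<in> E" "reachable (E - {f}) v b"
      from new(2)[OF va b f]
      have "cut V E f v \<subseteq> V - cut V E e v \<or> cut V E f v \<subseteq> cut V E e v - {y}" by auto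
      then have "card (cut V E f v) \<le> card (V - cut V E e v) \<or> card (cut V E f v) \<le> card (cut V E e v - {y})"
        by (meson card_mono finite_Diff finite_V finite_cut)
      \<comment> \<open>The cut lies among the \<open>s\<close> near vertices or the
        \<open>t - 1\<close> far ones other than \<open>y\<close>; by the gap between
        \<open>s\<close> and \<open>t\<close>, a size below \<open>t\<close> is at most
        \<open>s\<close>.\<close>
      then have "card (cut V E f v) \<le> s \<or> card (cut V E f v) < t"
        using sides(1,2)[OF e(2) y] by linarith
      then show "real (card (cut V E f v)) \<le> s" using cut_le[OF f(1) v(1)] by auto
    qed simp
    then have "risk V E v * (real s + real t) \<le> (\<alpha> + s) * (real s + real t)"
      by (intro mult_right_mono) auto
    then have "real s * real t - real s * real s \<le> \<alpha> * (real s + real t)"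
      using sep_v by (simp add: algebra_simps)
    moreover have "real s * (3 * real s) \<le> real s * (2 * real t)"
      using small by (intro mult_left_mono) auto
    ultimately show ?thesis
      using sep n by (simp add: algebra_simps)
  qed
qed (use assms in simp)

section \<open>Profiles and equilibria\<close>

text \<open>Its cardinality counts the links paid for, which exceeds the number of edges if requests
  are doubled.\<close>

definition requests :: "profile \<Rightarrow> (nat \<times> nat) set" where
  "requests S = {(v, w). S v w}"

lemma finite_players [simp]: "finite (players n)"
  by (simp add: players_def)

lemma card_players [simp]: "card (players n) = n"
  by (simp add: players_def)

lemma profilesD: "S \<in> profiles n \<Longrightarrow> S v w \<Longrightarrow> v \<in> players n \<and> w \<in> players n \<and> v \<noteq> w"
  by (auto simp: profiles_def)

lemma essential_imp_profile: "S \<in> essential_profiles n \<Longrightarrow> S \<in> profiles n"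
  by (simp add: essential_profiles_def)

lemma edges_eq:
  assumes "S \<in> profiles n"
  shows "edges n S = {{v, w} |v w. S v w}"
proof
  show "edges n S \<subseteq> {{v, w} |v w. S v w}"
    unfolding edges_def by (blast intro: insert_commute)
  show "{{v, w} |v w. S v w} \<subseteq> edges n S"
    unfolding edges_def using profilesD[OF assms] by blast
qed

lemma finite_graph_edges: "finite_graph (players n) (edges n S)"
  by unfold_locales (auto simp: edges_def)

lemma edges_image: "S \<in> profiles n \<Longrightarrow> edges n S = (\<lambda>(v, w). {v, w}) ` requests S"
  by (auto simp: edges_eq requests_def)

lemma finite_requests: "S \<in> profiles n \<Longrightarrow> finite (requests S)"
  by (rule finite_subset[of _ "players n \<times> players n"]) (auto simp: requests_def dest: profilesD)

lemma card_edges_le: "S \<in> profiles n \<Longrightarrow> card (edges n S) \<le> card (requests S)"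
  by (simp add: edges_image card_image_le finite_requests)

lemma card_edges_essential:
  assumes "S \<in> essential_profiles n"
  shows "card (edges n S) = card (requests S)"
proof -
  have "inj_on (\<lambda>(v, w). {v, w}) (requests S)"
    using assms by (auto simp: inj_on_def requests_def essential_profiles_def doubleton_eq_iff)
  then show ?thesis
    by (simp add: edges_image essential_imp_profile[OF assms] card_image)
qed

lemma sum_requests:
  assumes "S \<in> profiles n"
  shows "(\<Sum>v\<in>players n. \<Sum>w\<in>players n. of_bool (S v w) :: real) = real (card (requests S))"
proof -
  have "(\<Sum>v\<in>players n. \<Sum>w\<in>players n. of_bool (S v w) :: real) =
      (\<Sum>p\<in>players n \<times> players n. of_bool (S (fst p) (snd p)))"
    unfolding sum.cartesian_product split_def ..
  also have "\<dots> = real (card ((players n \<times> players n) \<inter> {p. S (fst p) (snd p)}))"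
    by (simp add: sum_of_bool_eq)
  also have "(players n \<times> players n) \<inter> {p. S (fst p) (snd p)} = requests S"
    using assms by (auto simp: requests_def dest: profilesD)
  finally show ?thesis .
qed

section \<open>Social cost and the lower bound on the optimum\<close>

lemma disconnection_cost_connected:
  "graph_connected V E \<Longrightarrow> disconnection_cost V E v = ereal (risk V E v)"
  by (simp add: disconnection_cost_def risk_def)

lemma edges_nonempty:
  assumes "2 \<le> n" "graph_connected (players n) (edges n S)"
  shows "edges n S \<noteq> {}"
proof -
  interpret finite_graph "players n" "edges n S" by (rule finite_graph_edges)
  interpret connected_graph "players n" "edges n S" by unfold_locales fact
  show ?thesis using card_V_le assms(1) by auto
qed

lemma social_cost_connected:
  assumes "2 \<le> n" "S \<in> profiles n" "graph_connected (players n) (edges n S)"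
  shows "social_cost n \<alpha> S =
    ereal (\<alpha> * real (card (requests S)) + real (sep_max (players n) (edges n S)))"
proof -
  interpret finite_graph "players n" "edges n S" by (rule finite_graph_edges)
  have "social_cost n \<alpha> S = ereal (\<Sum>v\<in>players n. \<alpha> * (\<Sum>w\<in>players n. of_bool (S v w))
      + risk (players n) (edges n S) v)"
    by (simp add: social_cost_def individual_cost_def disconnection_cost_connected[OF assms(3)])
  also have "(\<Sum>v\<in>players n. \<alpha> * (\<Sum>w\<in>players n. of_bool (S v w)) + risk (players n) (edges n S) v)
      = \<alpha> * real (card (requests S)) + real (sep_max (players n) (edges n S))"
    using sum_risk[OF edges_nonempty[OF assms(1,3)]] sum_requests[OF assms(2)]
    by (simp add: sum.distrib flip: sum_distrib_left)
  finally show ?thesis .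
qed

lemma social_cost_disconnected:
  assumes "0 < n" "\<not> graph_connected (players n) (edges n S)"
  shows "social_cost n \<alpha> S = \<infinity>"
proof -
  have "individual_cost n \<alpha> S v = \<infinity>" for v
    using assms(2) by (simp add: individual_cost_def disconnection_cost_def)
  moreover have "players n \<noteq> {}" using assms(1) by (simp add: players_def)
  ultimately show ?thesis
    by (auto simp: social_cost_def sum_Pinfty)
qed

text \<open>Either at least \<open>n\<close> requests are paid, or connectedness leaves exactly
  \<open>n - 1\<close> and the graph is a tree, in which each edge separates at least
  \<open>2 * (n - 1)\<close> ordered pairs.\<close>

lemma social_cost_ge:
  fixes \<alpha> :: real
  assumes "2 \<le> n" "0 < \<alpha>" "S \<in> profiles n"
  shows "ereal (min (\<alpha> * n) ((\<alpha> + 2) * (real n - 1))) \<le> social_cost n \<alpha> S"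
proof (cases "graph_connected (players n) (edges n S)")
  case True
  interpret finite_graph "players n" "edges n S" by (rule finite_graph_edges)
  interpret connected_graph "players n" "edges n S" by unfold_locales fact
  let ?k = "card (requests S)"
  have k: "card (edges n S) \<le> ?k" using card_edges_le assms(3) .
  have m: "n \<le> card (edges n S) + 1" using card_V_le by simp
  have "min (\<alpha> * n) ((\<alpha> + 2) * (real n - 1)) \<le> \<alpha> * real ?k + real (sep_max (players n) (edges n S))"
  proof (cases "n \<le> ?k")
    case True
    then have "\<alpha> * n \<le> \<alpha> * real ?k" using assms(2) by simp
    then show ?thesis by linarith
  next
    case False
    then have "card (edges n S) + 1 = card (players n)" and n: "n = ?k + 1" using k m by auto
    moreover obtain f where "f \<in> edges n S" using edges_nonempty[OF assms(1) True] by blast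
    ultimately have "2 * (n - 1) \<le> sep_max (players n) (edges n S)"
      using tree_separation separation_le_sep_max by fastforce
    then have "2 * real ?k \<le> real (sep_max (players n) (edges n S))" using n by linarith
    then show ?thesis using n by (simp add: algebra_simps)
  qed
  then show ?thesis by (simp only: social_cost_connected[OF assms(1,3) True] ereal_less_eq)
next
  case False
  then show ?thesis using assms(1) by (simp add: social_cost_disconnected)
qed

lemma OPT_ge:
  assumes "2 \<le> n" "0 < \<alpha>"
  shows "ereal (min (\<alpha> * n) ((\<alpha> + 2) * (real n - 1))) \<le> OPT n \<alpha>"
  unfolding OPT_def
proof (rule Min.boundedI)
  fix c assume "c \<in> social_cost n \<alpha> ` profiles n"
  then show "ereal (min (\<alpha> * n) ((\<alpha> + 2) * (real n - 1))) \<le> c"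
    using social_cost_ge[OF assms] by blast
qed (simp_all add: finite_profiles profiles_nonempty)

lemma OPT_le: "S \<in> profiles n \<Longrightarrow> OPT n \<alpha> \<le> social_cost n \<alpha> S"
  unfolding OPT_def using finite_profiles by (intro Min_le) auto

section \<open>Consequences of the equilibrium condition\<close>

lemma nash_equilibriumD:
  assumes "nash_equilibrium n \<alpha> S" "v \<in> players n" "S(v := s) \<in> profiles n"
  shows "individual_cost n \<alpha> S v \<le> individual_cost n \<alpha> (S(v := s)) v"
  using assms unfolding nash_equilibrium_def by (metis not_le)

lemma nash_profile: "nash_equilibrium n \<alpha> S \<Longrightarrow> S \<in> profiles n"
  by (simp add: nash_equilibrium_def essential_imp_profile)

text \<open>Any player can connect the graph by requesting edges to all others.\<close>

lemma nash_connected: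
  assumes "nash_equilibrium n \<alpha> S" "0 < n"
  shows "graph_connected (players n) (edges n S)"
proof (rule ccontr)
  assume disc: "\<not> ?thesis"
  define s where "s = (\<lambda>w. w \<in> players n \<and> w \<noteq> 1)"
  have one: "1 \<in> players n" using assms(2) by (simp add: players_def)
  have S': "S(1 := s) \<in> profiles n"
    using nash_profile[OF assms(1)] one by (auto simp: profiles_def s_def)
  have "reachable (edges n (S(1 := s))) 1 w" if "w \<in> players n" for w
    using that one by (cases "w = 1") (auto intro!: reachable_edge simp: edges_def s_def)
  then have "graph_connected (players n) (edges n (S(1 := s)))"
    unfolding graph_connected_def using reachable_sym reachable_trans by metis
  then have "individual_cost n \<alpha> (S(1 := s)) 1 < \<infinity>"
    by (simp add: individual_cost_def disconnection_cost_connected)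
  moreover have "individual_cost n \<alpha> S 1 = \<infinity>"
    using disc by (simp add: individual_cost_def disconnection_cost_def)
  ultimately show False using nash_equilibriumD[OF assms(1) one S'] by auto
qed

lemma individual_cost_upd:
  assumes "graph_connected (players n) (edges n (S(v := s)))"
  shows "individual_cost n \<alpha> (S(v := s)) v =
    ereal (\<alpha> * real (card {w \<in> players n. s w}) + risk (players n) (edges n (S(v := s))) v)"
  using assms by (simp add: individual_cost_def disconnection_cost_connected sum_of_bool_eq Int_def)

text \<open>The deviation adds one request to the row of \<open>a\<close>. This is the stability
  that \<open>sep_max_le\<close> asks for.\<close>

lemma nash_insert:
  assumes nash: "nash_equilibrium n \<alpha> S" and ab: "a \<in> players n" "b \<in> players n" "a \<noteq> b" "{a, b} \<notin> edges n S"
  shows "risk (players n) (edges n S) a \<le> \<alpha> + risk (players n) (insert {a, b} (edges n S)) a"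
proof -
  have S: "S \<in> profiles n" using nash_profile nash .
  have n: "0 < n" using ab(1) by (simp add: players_def)
  have con: "graph_connected (players n) (edges n S)" using nash_connected nash n .
  define s where "s = (S a)(b := True)"
  have S': "S(a := s) \<in> profiles n"
    using S ab by (auto simp: profiles_def s_def)
  have E: "edges n (S(a := s)) = insert {a, b} (edges n S)"
    unfolding edges_eq[OF S'] edges_eq[OF S]
    by (auto simp: s_def split: if_splits)
  have con': "graph_connected (players n) (edges n (S(a := s)))"
    using con unfolding E graph_connected_def by (blast intro: reachable_mono)
  have "\<not> S a b" using ab by (auto simp: edges_def)
  then have "{w \<in> players n. s w} = insert b {w \<in> players n. S a w}" "b \<notin> {w \<in> players n. S a w}"
    using ab by (auto simp: s_def)
  then have c: "card {w \<in> players n. s w} = card {w \<in> players n. S a w} + 1" by simp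
  show ?thesis
    using nash_equilibriumD[OF nash ab(1) S'] individual_cost_upd[OF con']
      individual_cost_upd[of n S a "S a"] con c E
    by (simp add: algebra_simps)
qed

text \<open>Withdrawing the request saves \<open>\<alpha> > 0\<close>, so in an equilibrium the risk
  must rise.\<close>

lemma nash_remove:
  assumes nash: "nash_equilibrium n \<alpha> S" and "0 < \<alpha>" and ab: "S a b"
    and con': "graph_connected (players n) (edges n S - {{a, b}})"
  shows "risk (players n) (edges n S) a < risk (players n) (edges n S - {{a, b}}) a"
proof -
  have S: "S \<in> profiles n" using nash_profile nash .
  have av: "a \<in> players n" "b \<in> players n" "a \<noteq> b" using profilesD[OF S ab] by auto
  have n: "0 < n" using av(1) by (simp add: players_def)
  have con: "graph_connected (players n) (edges n S)" using nash_connected nash n .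
  define s where "s = (S a)(b := False)"
  have S': "S(a := s) \<in> profiles n"
    using S by (auto simp: profiles_def s_def)
  \<comment> \<open>The profile is essential, so no opposite request keeps the edge alive.\<close>
  have "\<not> S b a" using nash ab by (auto simp: nash_equilibrium_def essential_profiles_def)
  then have "(S(a := s)) v w \<longleftrightarrow> S v w \<and> {v, w} \<noteq> {a, b}" for v w
    using av by (auto simp: s_def doubleton_eq_iff)
  then have E: "edges n (S(a := s)) = edges n S - {{a, b}}"
    unfolding edges_eq[OF S'] edges_eq[OF S] by blast
  have "{w \<in> players n. S a w} = insert b {w \<in> players n. s w}" "b \<notin> {w \<in> players n. s w}"
    using av ab by (auto simp: s_def)
  then have c: "card {w \<in> players n. S a w} = card {w \<in> players n. s w} + 1" by simp
  show ?thesis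
    using nash_equilibriumD[OF nash av(1) S'] individual_cost_upd[of n S a s] con'
      individual_cost_upd[of n S a "S a"] con c E assms(2)
    by (simp add: algebra_simps)
qed

text \<open>With more edges, the owner of a redundant one could withdraw it without raising her
  risk, contrary to \<open>nash_remove\<close>.\<close>

lemma nash_card_edges:
  assumes nash: "nash_equilibrium n \<alpha> S" and "0 < \<alpha>" "0 < n"
  shows "card (edges n S) \<le> 2 * (n - 1)"
proof (rule ccontr)
  assume *: "\<not> ?thesis"
  have S: "S \<in> profiles n" using nash_profile nash .
  interpret finite_graph "players n" "edges n S" by (rule finite_graph_edges)
  interpret connected_graph "players n" "edges n S"
    by unfold_locales (rule nash_connected[OF nash assms(3)])
  have "players n \<noteq> {}" using assms(3) by (simp add: players_def)
  then obtain a b where ab: "{a, b} \<in> edges n S" "\<And>f. reachable (edges n S - {{a, b}} - {f}) a b"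
    using redundant_edge * by auto
  \<comment> \<open>Stated for an ordered pair, because either end may be the owner.\<close>
  have redundant: False if r: "S p q" "{p, q} \<in> edges n S" "\<And>f. reachable (edges n S - {{p, q}} - {f}) p q" for p q
  proof -
    have "reachable (edges n S - {{p, q}}) p q" using r(3)[of "{p, q}"] by simp
    then interpret G: connected_graph "players n" "edges n S - {{p, q}}"
      using connected_remove r(2) by blast
    show False
      using nash_remove[OF nash assms(2) r(1) G.connected] risk_remove[OF r(2,3), of p] profilesD[OF S r(1)]
      by auto
  qed
  have "S a b \<or> S b a" using ab(1) unfolding edges_def by (auto simp: doubleton_eq_iff)
  then show False
    using redundant[of a b] redundant[of b a] ab reachable_sym[OF ab(2)] by (auto simp: insert_commute)
qed

text \<open>The constant is \<open>8 = 6 + 2\<close>: six from the separation, two from the at most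
  \<open>2 * n\<close> requests.\<close>

lemma nash_social_cost:
  assumes nash: "nash_equilibrium n \<alpha> S" and "0 < \<alpha>" "3 \<le> n"
  shows "social_cost n \<alpha> S \<le> ereal (8 * \<alpha> * n)"
proof -
  have n: "0 < n" "2 \<le> n" using assms(3) by auto
  have S: "S \<in> profiles n" "S \<in> essential_profiles n"
    using nash by (auto simp: nash_equilibrium_def essential_imp_profile)
  have con: "graph_connected (players n) (edges n S)" using nash_connected nash n(1) .
  interpret finite_graph "players n" "edges n S" by (rule finite_graph_edges)
  interpret connected_graph "players n" "edges n S" by unfold_locales fact
  have "real (sep_max (players n) (edges n S)) \<le> 6 * \<alpha> * n"
    using sep_max_le[OF _ assms(2) nash_insert[OF nash]] assms(3) by simp
  moreover have "real (card (requests S)) \<le> 2 * real n"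
    using nash_card_edges[OF nash assms(2) n(1)] card_edges_essential[OF S(2)] by linarith
  then have "\<alpha> * real (card (requests S)) \<le> \<alpha> * (2 * real n)"
    using assms(2) by (intro mult_left_mono) auto
  ultimately show ?thesis
    by (simp add: social_cost_connected[OF n(2) S(1) con])
qed

text \<open>Both terms of the minimum bounding the optimum are at least
  \<open>\<alpha> * (n - 1)\<close>, and \<open>8 * \<alpha> * n\<close> divided by this is
  \<open>8 + 8 / (n - 1)\<close>.\<close>

lemma nash_ratio:
  assumes nash: "nash_equilibrium n \<alpha> S" and "0 < \<alpha>" "3 \<le> n"
  shows "social_cost n \<alpha> S / OPT n \<alpha> \<le> ereal (8 + 8 / (real n - 1))"
proof -
  define L where "L = min (\<alpha> * n) ((\<alpha> + 2) * (real n - 1))"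
  have S: "S \<in> profiles n" using nash_profile nash .
  have "ereal L \<le> OPT n \<alpha>"
    unfolding L_def using assms by (intro OPT_ge) auto
  note opt = this OPT_le[OF S, of \<alpha>]
  have cost: "social_cost n \<alpha> S \<le> ereal (8 * \<alpha> * n)"
    using nash_social_cost[OF assms] .
  have L: "0 < L" using assms by (simp add: L_def)
  \<comment> \<open>The optimum lies between the real \<open>L\<close> and the finite cost of
    \<open>S\<close>, so the quotient is one of real numbers.\<close>
  obtain C where C: "social_cost n \<alpha> S = ereal C"
    using opt cost by (cases "social_cost n \<alpha> S") auto
  obtain D where D: "OPT n \<alpha> = ereal D"
    using opt C by (cases "OPT n \<alpha>") auto
  have D': "L \<le> D" and C': "C \<le> 8 * \<alpha> * n" using opt cost C D by auto
  have "8 * \<alpha> * n * (real n - 1) \<le> 8 * n * L"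
  proof -
    have "\<alpha> * (real n - 1) \<le> \<alpha> * n" using assms(2) by simp
    moreover have "\<alpha> * (real n - 1) \<le> (\<alpha> + 2) * (real n - 1)"
      using assms(3) by (intro mult_right_mono) auto
    ultimately have "\<alpha> * (real n - 1) \<le> L" by (simp add: L_def)
    then have "8 * n * (\<alpha> * (real n - 1)) \<le> 8 * n * L" by (intro mult_left_mono) auto
    then show ?thesis by (simp add: algebra_simps)
  qed
  also have "\<dots> \<le> 8 * n * D" using D' by (intro mult_left_mono) auto
  finally have "C * (real n - 1) \<le> 8 * n * D"
    using mult_right_mono[OF C', of "real n - 1"] assms(3) by linarith
  then have "C / D \<le> 8 * n / (real n - 1)"
    using L D' assms(3) by (simp add: field_simps)
  also have "\<dots> = 8 + 8 / (real n - 1)"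
    using assms(3) by (simp add: field_simps)
  finally show ?thesis
    using L D' by (simp add: C D)
qed

theorem mainTheorem5:
  "(\<forall>(n::nat) (\<alpha>::real) S. 3 \<le> n \<longrightarrow> 0 < \<alpha> \<longrightarrow> nash_equilibrium n \<alpha> S \<longrightarrow>
      social_cost n \<alpha> S / OPT n \<alpha> \<le> ereal (8 + 8 / (real n - 1))) \<and>
   (\<forall>(n::nat) (\<alpha>::real). 3 \<le> n \<longrightarrow> 0 < \<alpha> \<longrightarrow>
      price_of_anarchy n \<alpha> \<le> ereal (8 + 8 / (real n - 1))) \<and>
   (\<lambda>n::nat. (8 + 8 / (real n - 1)) - 8) \<in> o(\<lambda>_. 1 :: real)"
proof (intro conjI allI impI)
  fix n :: nat and \<alpha> :: real
  assume "3 \<le> n" "0 < \<alpha>"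
  then show "price_of_anarchy n \<alpha> \<le> ereal (8 + 8 / (real n - 1))"
    unfolding price_of_anarchy_def by (intro SUP_least) (simp add: nash_ratio)
next
  have "filterlim (\<lambda>n::nat. real n - 1) at_top sequentially"
    using filterlim_tendsto_add_at_top[OF tendsto_const[of "-1"] filterlim_real_sequentially] by simp
  then have "(\<lambda>n::nat. 8 / (real n - 1)) \<longlonglongrightarrow> 0"
    by (intro tendsto_divide_0[OF tendsto_const] filterlim_at_top_imp_at_infinity)
  then show "(\<lambda>n::nat. (8 + 8 / (real n - 1)) - 8) \<in> o(\<lambda>_. 1 :: real)"
    by (intro smalloI_tendsto) auto
qed (rule nash_ratio)

end
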